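(* Let $p\ge 1$. The set of proper complex $2p\times 2p$ covariance matrices is equal to $\mathcal{F}(\mathcal{K})$ with $\mathcal{K}=\{\mathbf{L}_0,\mathbf{L}_1\}$, where $\mathbf{L}_0=\mathbf{I}_{2p}$ and $\mathbf{L}_1=\begin{pmatrix} 0&1\\ -1&0\end{pmatrix}\otimes \mathbf{I}_p$.
   Context: $\mathcal{P}(m)$ denotes the set of real symmetric positive definite $m\times m$ matrices, $\mathbf{I}_m$ the $m\times m$ identity matrix, and $\otimes$ the Kronecker product. For a set $\mathcal{K}$ of real orthogonal $m\times m$ matrices, $$\mathcal{F}(\mathcal{K}) = \{ \mathbf{Q} \in \mathcal{P}(m) \;:\; \mathbf{Q} = \mathbf{L}\mathbf{Q}\mathbf{L}^T \text{ for all } \mathbf{L} \in \mathcal{K} \}.$$ The set of proper complex $2p\times 2p$ covariance matrices is the set of $\mathbf{Q}\in\mathcal{P}(2p)$ such that $\mathbf{Q}=\mathbf{L}_\theta\mathbf{Q}\mathbf{L}_\theta^T$ for every $\theta\in\mathbb{R}$, where $$\mathbf{L}_\theta=\begin{pmatrix}\cos\theta & \sin\theta\\ -\sin\theta & \cos\theta\end{pmatrix}\otimes\mathbf{I}_p .$$ *)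

theory Defs
  imports "HOL-Analysis.Analysis"
begin

definition pos_def_matrices :: "(real^'m^'m) set"
  where "pos_def_matrices = {Q. transpose Q = Q \<and> (\<forall>x. x \<noteq> 0 \<longrightarrow> x \<bullet> (Q *v x) > 0)}"

(* The index set of a Kronecker product is the product of the index sets; the first component
   is the block index and the second the position within a block. Hence a matrix over the index
   type 2 * 'p has size 2p with p = CARD('p), and p >= 1 because types are nonempty. *)
definition kronecker :: "real^'b^'a \<Rightarrow> real^'d^'c \<Rightarrow> real^('b \<times> 'd)^('a \<times> 'c)"  (infixl "\<otimes>\<^sub>K" 70)
  where "A \<otimes>\<^sub>K B = (\<chi> i j. A $ fst i $ fst j * B $ snd i $ snd j)"

definition matrix22 :: "real \<Rightarrow> real \<Rightarrow> real \<Rightarrow> real \<Rightarrow> real^2^2"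
  where "matrix22 a b c d = vector [vector [a, b], vector [c, d]]"

(* Meant for sets K of orthogonal matrices; the lemmas below check this for the matrices
   to which it is applied. *)
definition invariant_pos_def :: "(real^'m^'m) set \<Rightarrow> (real^'m^'m) set"
  where "invariant_pos_def K = {Q \<in> pos_def_matrices. \<forall>L\<in>K. Q = L ** Q ** transpose L}"

definition proper_rotation :: "real \<Rightarrow> real^(2 \<times> 'p::finite)^(2 \<times> 'p)"
  where "proper_rotation \<theta> = matrix22 (cos \<theta>) (sin \<theta>) (- sin \<theta>) (cos \<theta>) \<otimes>\<^sub>K mat 1"

definition proper_complex_covariances :: "(real^(2 \<times> 'p::finite)^(2 \<times> 'p)) set"
  where "proper_complex_covariances =
    {Q \<in> pos_def_matrices. \<forall>\<theta>. Q = proper_rotation \<theta> ** Q ** transpose (proper_rotation \<theta>)}"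

lemma kronecker_mult: "(A \<otimes>\<^sub>K B) ** (C \<otimes>\<^sub>K D) = (A ** C) \<otimes>\<^sub>K (B ** D)"
  by (simp add: kronecker_def matrix_matrix_mult_def vec_eq_iff sum_product sum.cartesian_product'
      UNIV_Times_UNIV[symmetric] mult_ac del: UNIV_Times_UNIV)

lemma transpose_kronecker: "transpose (A \<otimes>\<^sub>K B) = transpose A \<otimes>\<^sub>K transpose B"
  by (simp add: kronecker_def transpose_def)

lemma kronecker_mat_1: "(mat 1 \<otimes>\<^sub>K mat 1 :: real^('a::finite \<times> 'b::finite)^('a \<times> 'b)) = mat 1"
  by (auto simp: kronecker_def mat_def vec_eq_iff prod_eq_iff)

lemma orthogonal_matrix_kronecker:
  assumes "orthogonal_matrix A" "orthogonal_matrix B"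
  shows "orthogonal_matrix (A \<otimes>\<^sub>K B)"
  using assms by (simp add: orthogonal_matrix_def transpose_kronecker kronecker_mult kronecker_mat_1)

lemma orthogonal_matrix22:
  assumes "a\<^sup>2 + b\<^sup>2 = 1"
  shows "orthogonal_matrix (matrix22 a b (- b) a)"
  using assms
  by (simp add: orthogonal_matrix matrix22_def matrix_matrix_mult_def transpose_def mat_def
      vec_eq_iff sum_2 forall_2 power2_eq_square add.commute)

lemma orthogonal_proper_rotation: "orthogonal_matrix (proper_rotation \<theta>)"
  unfolding proper_rotation_def
  by (intro orthogonal_matrix_kronecker orthogonal_matrix22 orthogonal_matrix_id) simp

lemma orthogonal_quarter_turn: "orthogonal_matrix (matrix22 0 1 (-1) 0 \<otimes>\<^sub>K mat 1)"
  by (intro orthogonal_matrix_kronecker orthogonal_matrix22 orthogonal_matrix_id) simp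

end

theory Submission
  imports Defs
begin

text \<open>
  For an orthogonal matrix \<open>L\<close>, the condition \<open>Q = L Q L\<^sup>T\<close> says that \<open>Q\<close> commutes with \<open>L\<close>.
  Every rotation \<open>L\<^sub>\<theta>\<close> is the linear combination \<open>cos \<theta> I + sin \<theta> L\<^sub>1\<close>, so a matrix that
  commutes with the quarter turn \<open>L\<^sub>1\<close> commutes with all rotations; conversely
  \<open>L\<^sub>1\<close> is the rotation with \<open>\<theta> = \<pi>/2\<close>.
\<close>

lemma orthogonal_matrix_conj_fixed_iff_commute:
  fixes L Q :: "real^'n^'n"
  assumes "orthogonal_matrix L"
  shows "Q = L ** Q ** transpose L \<longleftrightarrow> L ** Q = Q ** L"
proof
  assume "Q = L ** Q ** transpose L"
  then have "Q ** L = (L ** Q) ** (transpose L ** L)"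
    by (metis matrix_mul_assoc)
  then show "L ** Q = Q ** L"
    using assms by (simp add: orthogonal_matrix_def)
next
  assume "L ** Q = Q ** L"
  then have "L ** Q ** transpose L = Q ** (L ** transpose L)"
    by (simp add: matrix_mul_assoc)
  then show "Q = L ** Q ** transpose L"
    using assms by (simp add: orthogonal_matrix_def)
qed

lemma matrix_add_rdistrib: "(B + C) ** A = (B ** A) + (C ** A)"
  by (simp add: matrix_matrix_mult_def vec_eq_iff distrib_right sum.distrib)

lemma proper_rotation_pi_half: "proper_rotation (pi/2) = matrix22 0 1 (-1) 0 \<otimes>\<^sub>K mat 1"
  by (simp add: proper_rotation_def)

text \<open>The identity holds already for the 2 x 2 factors, and the Kronecker product is linear in
  its left factor.\<close>

lemma proper_rotation_eq_combination:
  "proper_rotation \<theta> = cos \<theta> *\<^sub>R mat 1 + sin \<theta> *\<^sub>R (matrix22 0 1 (-1) 0 \<otimes>\<^sub>K mat 1)"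
  by (simp add: proper_rotation_def kronecker_def matrix22_def mat_def vec_eq_iff forall_2)

lemma commute_proper_rotation:
  assumes "J ** Q = Q ** J" and "J = matrix22 0 1 (-1) 0 \<otimes>\<^sub>K mat 1"
  shows "proper_rotation \<theta> ** Q = Q ** proper_rotation \<theta>"
  \<comment> \<open>Folding the quarter turn back into \<open>J\<close> lets the commutation
    hypothesis rewrite the sine term; the cosine term is a multiple of the identity.\<close>
  unfolding proper_rotation_eq_combination assms(2)[symmetric]
  by (simp add: matrix_add_ldistrib matrix_add_rdistrib matrix_scalar_ac scalar_matrix_assoc[symmetric]
      assms(1))

theorem proposition2:
  shows "(proper_complex_covariances :: (real^(2 \<times> 'p::finite)^(2 \<times> 'p)) set) =
    invariant_pos_def {mat 1, matrix22 0 1 (-1) 0 \<otimes>\<^sub>K mat 1}"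
proof -
  have "(\<forall>\<theta>. Q = proper_rotation \<theta> ** Q ** transpose (proper_rotation \<theta>)) \<longleftrightarrow>
      Q = L ** Q ** transpose L"
    if "L = matrix22 0 1 (-1) 0 \<otimes>\<^sub>K mat 1" for Q L :: "real^(2 \<times> 'p)^(2 \<times> 'p)"
    using that commute_proper_rotation[of L Q] proper_rotation_pi_half
    by (metis orthogonal_matrix_conj_fixed_iff_commute orthogonal_proper_rotation)
  \<comment> \<open>For \<open>mat 1\<close> the invariance condition reads \<open>Q = Q\<close>, so
    only the one for the quarter turn remains.\<close>
  then show ?thesis
    by (simp add: proper_complex_covariances_def invariant_pos_def_def)
qed

end
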